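(* Let $B$ be a set of black squares and let $n\geq0$ be an even integer. Then $$\sum_{\lambda}(-1)^{v(\lambda)}I_\lambda^2=0,$$ where the sum is taken over all shapes $\lambda\vdash n$ whose set of black squares is exactly $B$.
   Context: A shape $\lambda$ is the Ferrers diagram of an integer partition, with square $(r,c)$ in row $r$ and column $c$; chess colouring: $(r,c)$ is black if $r+c$ is even, white if odd. $\lambda\vdash n$ means $\lambda$ has $n$ squares. A standard Young tableau (SYT) on an $n$-shape is a filling with $1,\ldots,n$, each once, increasing along rows and down columns. The sign $\mathrm{sgn}(T)$ of a tableau is the sign of the word obtained by reading its entries row by row, left to right, top to bottom; the sign of a word of distinct integers is $(-1)^{\#\text{inversions}}$. $I_\lambda=\sum_{T\in\mathrm{SYT}(\lambda)}\mathrm{sgn}(T)$. $v(\lambda)$ is the maximal number of disjoint vertical dominoes ($2\times1$ rectangles) that fit in $\lambda$.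
   Formalization: The single case n = 0 with B empty is excluded, since there the only shape is the empty one, with v = 0 and I = 1, so the sum equals 1 rather than 0. *)

theory Defs
  imports Complex_Main
begin

type_synonym square = "nat \<times> nat"

text \<open>Partitions are weakly decreasing lists of positive parts. Rows and columns are
  numbered from 1, so the square \<open>(r, c)\<close> lies in row \<open>r\<close>, whose length is entry \<open>r - 1\<close>
  of the list.\<close>

definition integer_partition :: "nat list \<Rightarrow> bool" where
  "integer_partition p \<longleftrightarrow> sorted_wrt (\<ge>) p \<and> (\<forall>k \<in> set p. k > 0)"

definition ferrers_diagram :: "nat list \<Rightarrow> square set" where
  "ferrers_diagram p = {(r, c). 1 \<le> r \<and> r \<le> length p \<and> 1 \<le> c \<and> c \<le> p ! (r - 1)}"

definition shape :: "square set \<Rightarrow> bool" where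
  "shape S \<longleftrightarrow> (\<exists>p. integer_partition p \<and> S = ferrers_diagram p)"

definition black :: "square \<Rightarrow> bool" where
  "black s \<longleftrightarrow> even (fst s + snd s)"

definition all_squares :: "square set" where
  "all_squares = {(r, c). 1 \<le> r \<and> 1 \<le> c}"

text \<open>A filling takes the value \<open>undefined\<close> outside the shape, so that distinct elements of
  \<open>SYT S\<close> are distinct tableaux.\<close>

definition SYT :: "square set \<Rightarrow> (square \<Rightarrow> nat) set" where
  "SYT S = {T. (\<forall>s. s \<notin> S \<longrightarrow> T s = undefined)
      \<and> bij_betw T S {1..card S}
      \<and> (\<forall>r c c'. (r, c) \<in> S \<and> (r, c') \<in> S \<and> c < c' \<longrightarrow> T (r, c) < T (r, c'))
      \<and> (\<forall>r r' c. (r, c) \<in> S \<and> (r', c) \<in> S \<and> r < r' \<longrightarrow> T (r, c) < T (r', c))}"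

definition reading_word :: "square set \<Rightarrow> (square \<Rightarrow> nat) \<Rightarrow> nat list" where
  "reading_word S T =
     concat (map (\<lambda>r. map (\<lambda>c. T (r, c)) (sorted_list_of_set {c. (r, c) \<in> S}))
                 (sorted_list_of_set (fst ` S)))"

definition inversions :: "nat list \<Rightarrow> (nat \<times> nat) set" where
  "inversions w = {(i, j). i < j \<and> j < length w \<and> w ! i > w ! j}"

definition word_sign :: "nat list \<Rightarrow> int" where
  "word_sign w = (-1) ^ card (inversions w)"

definition tableau_sign :: "square set \<Rightarrow> (square \<Rightarrow> nat) \<Rightarrow> int" where
  "tableau_sign S T = word_sign (reading_word S T)"

definition sign_imbalance :: "square set \<Rightarrow> int" where
  "sign_imbalance S = (\<Sum>T \<in> SYT S. tableau_sign S T)"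

definition vertical_domino :: "square set \<Rightarrow> bool" where
  "vertical_domino d \<longleftrightarrow> (\<exists>r c. d = {(r, c), (r + 1, c)})"

definition max_vertical_dominoes :: "square set \<Rightarrow> nat" where
  "max_vertical_dominoes S =
     Max {card D | D. (\<forall>d \<in> D. vertical_domino d \<and> d \<subseteq> S) \<and> pairwise disjnt D}"

end

theory Submission
  imports Defs
begin

text \<open>Deleting the largest entry gives $I_\lambda = \sum_d \varepsilon(\lambda, d) I_{\lambda - d}$
  over the removable squares $d$, where $\varepsilon(\lambda, d)$ is $-1$ to the number of squares in
  rows below $d$. Exchanging two incomparable squares reverses $\varepsilon$, and two squares
  of the same colour are never adjacent. Hence consecutive removals of equally coloured squares cancel,
  and $I_\lambda \ne 0$ forces the colours to alternate: as many black as white squares if $n$ is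
  even, one more black square if $n$ is odd.

  The same exchange makes adding a square anticommute with its adjoint for the form
  weighted by $(-1)^{v(\lambda)}$, up to the identity operator. For even $n$ the adjoint therefore annihilates
  $\sum_{\lambda \vdash n} I_\lambda \lambda$. Expanding one factor of $I_\lambda^2$, only white squares
  $d$ contribute, by the colour count; so the sum can be regrouped by $\mu = \lambda - d$, which has the same
  black squares as $\lambda$, and each group vanishes.\<close>

section \<open>Shapes and their corners\<close>

definition row_length :: "square set \<Rightarrow> nat \<Rightarrow> nat" where
  "row_length S r = card {c. (r, c) \<in> S}"

lemma down_closed_eq_atLeastAtMost:
  fixes X :: "nat set"
  assumes "finite X" "0 \<notin> X" "\<And>x y. x \<in> X \<Longrightarrow> 1 \<le> y \<Longrightarrow> y \<le> x \<Longrightarrow> y \<in> X"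
  shows "X = {1..card X}"
proof (cases "X = {}")
  case False
  have "X = {1..Max X}"
  proof (intro equalityI subsetI)
    fix x assume "x \<in> X"
    moreover have "x \<noteq> 0" using \<open>x \<in> X\<close> assms(2) by metis
    ultimately show "x \<in> {1..Max X}" using assms(1) by auto
  next
    fix x assume "x \<in> {1..Max X}"
    then show "x \<in> X" using assms(3)[of "Max X" x] assms(1) False by auto
  qed
  then show ?thesis by (metis card_atLeastAtMost diff_Suc_1)
qed simp

text \<open>Together with \<open>shapeI\<close> this trades lists of parts for finite down-closed
  sets of squares with positive coordinates, the form in which shapes are handled from here
  on.\<close>

lemma shapeD:
  assumes "shape S"
  shows "finite S" and "S \<subseteq> all_squares"
    and "\<And>r c r' c'. (r, c) \<in> S \<Longrightarrow> 1 \<le> r' \<Longrightarrow> r' \<le> r \<Longrightarrow> 1 \<le> c' \<Longrightarrow> c' \<le> c \<Longrightarrow> (r', c') \<in> S"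
proof -
  obtain p where p: "integer_partition p" "S = ferrers_diagram p"
    using assms by (auto simp: shape_def)
  have "S \<subseteq> {1..length p} \<times> {1..Max (set p)}"
    by (auto simp: p(2) ferrers_diagram_def intro!: order_trans[OF _ Max_ge])
  then show "finite S" by (rule finite_subset) simp
  show "S \<subseteq> all_squares" by (auto simp: p(2) ferrers_diagram_def all_squares_def)
  fix r c r' c' assume *: "(r, c) \<in> S" "1 \<le> r'" "r' \<le> r" "1 \<le> c'" "c' \<le> c"
  have "p ! (r - 1) \<le> p ! (r' - 1)"
  proof (cases "r' = r")
    case False
    then show ?thesis using p * by (auto simp: integer_partition_def sorted_wrt_iff_nth_less ferrers_diagram_def)
  qed simp
  then show "(r', c') \<in> S" using * by (auto simp: p(2) ferrers_diagram_def)
qed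

text \<open>The parts are read off the set: by down-closure the first column and every row are
  initial segments, the column giving the number of parts and the rows their sizes.\<close>

lemma shapeI:
  assumes fin: "finite S" and sub: "S \<subseteq> all_squares"
    and down: "\<And>r c r' c'. (r, c) \<in> S \<Longrightarrow> 1 \<le> r' \<Longrightarrow> r' \<le> r \<Longrightarrow> 1 \<le> c' \<Longrightarrow> c' \<le> c \<Longrightarrow> (r', c') \<in> S"
  shows "shape S"
proof -
  have finr: "finite {c. (r, c) \<in> S}" for r
    by (rule finite_subset[OF _ finite_imageI[OF fin, of snd]]) force
  have row: "{c. (r, c) \<in> S} = {1..row_length S r}" for r
    unfolding row_length_def
  proof (rule down_closed_eq_atLeastAtMost)
    show "0 \<notin> {c. (r, c) \<in> S}" using sub by (auto simp: all_squares_def)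
    fix x y assume "x \<in> {c. (r, c) \<in> S}" "1 \<le> y" "y \<le> x"
    then show "y \<in> {c. (r, c) \<in> S}" using down[of r x r y] sub by (auto simp: all_squares_def)
  qed (rule finr)
  define m where "m = card {r. (r, 1) \<in> S}"
  have col: "{r. (r, 1) \<in> S} = {1..m}"
    unfolding m_def
  proof (rule down_closed_eq_atLeastAtMost)
    show "finite {r. (r, 1) \<in> S}"
      by (rule finite_subset[OF _ finite_imageI[OF fin, of fst]]) force
    show "0 \<notin> {r. (r, 1) \<in> S}" using sub by (auto simp: all_squares_def)
    fix x y assume "x \<in> {r. (r, 1) \<in> S}" "1 \<le> y" "y \<le> x"
    then show "y \<in> {r. (r, 1) \<in> S}" using down[of x 1 y 1] by auto
  qed
  define p where "p = map (\<lambda>i. row_length S (Suc i)) [0..<m]"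
  have mem: "(r, c) \<in> S \<longleftrightarrow> 1 \<le> c \<and> c \<le> row_length S r" for r c
    using row[of r] by (metis atLeastAtMost_iff mem_Collect_eq)
  have memcol: "(r, 1) \<in> S \<longleftrightarrow> 1 \<le> r \<and> r \<le> m" for r
    using col by (metis atLeastAtMost_iff mem_Collect_eq)
  have dec: "row_length S r \<le> row_length S r'" if "1 \<le> r'" "r' \<le> r" for r r'
    unfolding row_length_def
  proof (rule card_mono[OF finr], rule subsetI)
    fix c assume "c \<in> {c. (r, c) \<in> S}"
    then show "c \<in> {c. (r', c) \<in> S}" using that down[of r c r' c] sub by (auto simp: all_squares_def)
  qed
  have "integer_partition p"
    unfolding integer_partition_def
  proof
    show "sorted_wrt (\<ge>) p" by (auto simp: p_def sorted_wrt_iff_nth_less intro!: dec)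
    have "0 < row_length S (Suc i)" if "i < m" for i
      using that memcol[of "Suc i"] mem[of "Suc i" 1] by auto
    then show "\<forall>k\<in>set p. k > 0" by (auto simp: p_def)
  qed
  moreover have "S = ferrers_diagram p"
  proof (rule set_eqI, clarify)
    fix r c
    have "(r, c) \<in> S \<longleftrightarrow> 1 \<le> r \<and> r \<le> m \<and> 1 \<le> c \<and> c \<le> row_length S r"
      using mem[of r c] mem[of r 1] memcol[of r] by auto
    also have "\<dots> \<longleftrightarrow> (r, c) \<in> ferrers_diagram p"
      by (auto simp: ferrers_diagram_def p_def)
    finally show "(r, c) \<in> S \<longleftrightarrow> (r, c) \<in> ferrers_diagram p" .
  qed
  ultimately show ?thesis by (auto simp: shape_def)
qed

lemma shape_Un: "shape S \<Longrightarrow> shape T \<Longrightarrow> shape (S \<union> T)"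
  by (rule shapeI) (auto dest: shapeD)

lemma shape_Int: "shape S \<Longrightarrow> shape T \<Longrightarrow> shape (S \<inter> T)"
  by (rule shapeI) (auto dest: shapeD)

lemma shape_mem_iff:
  assumes "shape S"
  shows "(r, c) \<in> S \<longleftrightarrow> 1 \<le> r \<and> 1 \<le> c \<and> c \<le> row_length S r"
proof (cases "1 \<le> r")
  case True
  have "{c. (r, c) \<in> S} = {1..row_length S r}"
    unfolding row_length_def
  proof (rule down_closed_eq_atLeastAtMost)
    show "finite {c. (r, c) \<in> S}"
      by (rule finite_subset[OF _ finite_imageI[OF shapeD(1)[OF assms], of snd]]) force
    show "0 \<notin> {c. (r, c) \<in> S}" using shapeD(2)[OF assms] by (auto simp: all_squares_def)
    fix x y assume "x \<in> {c. (r, c) \<in> S}" "1 \<le> y" "y \<le> x"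
    then show "y \<in> {c. (r, c) \<in> S}" using shapeD(3)[OF assms, of r x r y] True by auto
  qed
  then show ?thesis using True by (metis atLeastAtMost_iff mem_Collect_eq)
next
  case False
  then show ?thesis using shapeD(2)[OF assms] by (auto simp: all_squares_def)
qed

text \<open>A shape containing \<open>(r, c)\<close> contains the \<open>r\<close> squares of column
  \<open>c\<close> down to it and the \<open>c\<close> squares of row \<open>r\<close> up to it, so
  it fits into an \<open>n\<close> by \<open>n\<close> box.\<close>

lemma finite_shapes: "finite {S. shape S \<and> card S = n}"
proof (rule finite_subset)
  show "{S. shape S \<and> card S = n} \<subseteq> Pow ({1..n} \<times> {1..n})"
  proof clarify
    fix S r c assume S: "shape S" "n = card S" and rc: "(r, c) \<in> S"
    have pos: "1 \<le> r" "1 \<le> c" using shapeD(2)[OF S(1)] rc by (auto simp: all_squares_def)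
    have "card ((\<lambda>i. (i, c)) ` {1..r}) \<le> card S"
      using shapeD(3)[OF S(1) rc] pos by (intro card_mono shapeD(1)[OF S(1)]) auto
    moreover have "card (Pair r ` {1..c}) \<le> card S"
      using shapeD(3)[OF S(1) rc] pos by (intro card_mono shapeD(1)[OF S(1)]) auto
    ultimately show "r \<in> {1..card S} \<and> c \<in> {1..card S}" using pos
      by (simp add: card_image inj_on_def)
  qed
qed simp

section \<open>Addable and removable squares\<close>

definition addable :: "square set \<Rightarrow> square set" where
  "addable S = {c. c \<notin> S \<and> shape (insert c S)}"

text \<open>Like \<open>addable\<close>, this asks only that the resulting set be a shape, so adding
  and removing a square are inverse by definition; the criteria in terms of row lengths are
  derived.\<close>

definition removable :: "square set \<Rightarrow> square set" where
  "removable S = {d \<in> S. shape (S - {d})}"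

lemma finite_removable: "finite S \<Longrightarrow> finite (removable S)"
  by (simp add: removable_def)

lemma mem_addable_iff:
  assumes "shape S"
  shows "(r, c) \<in> addable S \<longleftrightarrow>
    1 \<le> r \<and> c = Suc (row_length S r) \<and> (r = 1 \<or> row_length S r < row_length S (r - 1))"
proof
  assume "(r, c) \<in> addable S"
  then have nin: "(r, c) \<notin> S" and sh: "shape (insert (r, c) S)" by (auto simp: addable_def)
  have pos: "1 \<le> r" "1 \<le> c" using shapeD(2)[OF sh] by (auto simp: all_squares_def)
  have gt: "row_length S r < c" using nin pos shape_mem_iff[OF assms, of r c] by auto
  have "c = Suc (row_length S r)"
    using shapeD(3)[OF sh, of r c r "Suc (row_length S r)"] pos gt
      shape_mem_iff[OF assms, of r "Suc (row_length S r)"] by auto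
  moreover have "r = 1 \<or> row_length S r < row_length S (r - 1)"
  proof (cases "r = 1")
    case False
    then have r: "1 \<le> r - 1" "r - 1 \<noteq> r" using pos by auto
    then have "(r - 1, c) \<in> S" using shapeD(3)[OF sh, of r c "r - 1" c] pos by auto
    then show ?thesis
      using shape_mem_iff[OF assms, of "r - 1" c] gt by auto
  qed simp
  ultimately show "1 \<le> r \<and> c = Suc (row_length S r) \<and> (r = 1 \<or> row_length S r < row_length S (r - 1))"
    using pos by blast
next
  assume *: "1 \<le> r \<and> c = Suc (row_length S r) \<and> (r = 1 \<or> row_length S r < row_length S (r - 1))"
  have "shape (insert (r, c) S)"
  proof (rule shapeI)
    show "finite (insert (r, c) S)" using shapeD(1)[OF assms] by simp
    show "insert (r, c) S \<subseteq> all_squares" using * shapeD(2)[OF assms] by (auto simp: all_squares_def)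
    fix a b a' b' assume **: "(a, b) \<in> insert (r, c) S" "1 \<le> a'" "a' \<le> a" "1 \<le> b'" "b' \<le> b"
    show "(a', b') \<in> insert (r, c) S"
    proof (cases "(a, b) \<in> S")
      case True
      then show ?thesis using shapeD(3)[OF assms True] ** by auto
    next
      case False
      then have [simp]: "a = r" "b = c" using ** by auto
      show ?thesis
      proof (cases "a' = r")
        case True
        then show ?thesis using * ** shape_mem_iff[OF assms, of r b'] by auto
      next
        case False
        then have "(r - 1, c) \<in> S" using * ** shape_mem_iff[OF assms, of "r - 1" c] by auto
        then show ?thesis using shapeD(3)[OF assms, of "r - 1" c a' b'] ** False by auto
      qed
    qed
  qed
  then show "(r, c) \<in> addable S"
    using * shape_mem_iff[OF assms, of r c] by (auto simp: addable_def)
qed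

lemma mem_removable_iff:
  assumes "shape S"
  shows "(r, c) \<in> removable S \<longleftrightarrow>
    1 \<le> r \<and> c = row_length S r \<and> row_length S (Suc r) < row_length S r"
proof
  assume "(r, c) \<in> removable S"
  then have inS: "(r, c) \<in> S" and sh: "shape (S - {(r, c)})" by (auto simp: removable_def)
  have pos: "1 \<le> r" "1 \<le> c" "c \<le> row_length S r" using inS shape_mem_iff[OF assms, of r c] by auto
  have "(r, Suc c) \<notin> S" using shapeD(3)[OF sh, of r "Suc c" r c] pos by auto
  moreover have "(Suc r, c) \<notin> S" using shapeD(3)[OF sh, of "Suc r" c r c] pos by auto
  ultimately show "1 \<le> r \<and> c = row_length S r \<and> row_length S (Suc r) < row_length S r"
    using pos shape_mem_iff[OF assms, of r "Suc c"] shape_mem_iff[OF assms, of "Suc r" c] by auto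
next
  assume *: "1 \<le> r \<and> c = row_length S r \<and> row_length S (Suc r) < row_length S r"
  have "shape (S - {(r, c)})"
  proof (rule shapeI)
    show "finite (S - {(r, c)})" using shapeD(1)[OF assms] by simp
    show "S - {(r, c)} \<subseteq> all_squares" using shapeD(2)[OF assms] by auto
    fix a b a' b' assume **: "(a, b) \<in> S - {(r, c)}" "1 \<le> a'" "a' \<le> a" "1 \<le> b'" "b' \<le> b"
    have "(a', b') \<noteq> (r, c)"
    proof
      assume eq: "(a', b') = (r, c)"
      show False
      proof (cases "a = r")
        case True
        then show False using eq * ** shape_mem_iff[OF assms, of a b] by auto
      next
        case False
        then have "(Suc r, c) \<in> S" using eq ** shapeD(3)[OF assms, of a b "Suc r" c] by auto
        then show False using * shape_mem_iff[OF assms, of "Suc r" c] by auto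
      qed
    qed
    then show "(a', b') \<in> S - {(r, c)}" using shapeD(3)[OF assms, of a b a' b'] ** by auto
  qed
  then show "(r, c) \<in> removable S"
    using * shape_mem_iff[OF assms, of r c] by (auto simp: removable_def)
qed

text \<open>The factor by which the weight \<open>(-1) ^ max_vertical_dominoes S\<close> changes
  when the square is added: -1 exactly in even rows.\<close>

definition row_sign :: "square \<Rightarrow> int" where
  "row_sign s = (-1) ^ (fst s + 1)"

text \<open>Inner and outer corners alternate along the boundary: row \<open>r + 1\<close> being
  strictly shorter than row \<open>r\<close> makes the end of row \<open>r\<close> removable and row
  \<open>r + 1\<close> extendable. Only the extension of row 1 has no partner.\<close>

lemma addable_eq_insert_image_removable:
  assumes "shape S"
  shows "addable S = insert (1, Suc (row_length S 1))
    ((\<lambda>(r, c). (Suc r, Suc (row_length S (Suc r)))) ` removable S)" (is "_ = insert _ (?f ` _)")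
proof (intro equalityI subsetI)
  fix x assume x: "x \<in> addable S"
  obtain r c where [simp]: "x = (r, c)" by fastforce
  show "x \<in> insert (1, Suc (row_length S 1)) (?f ` removable S)"
  proof (cases "r = 1")
    case False
    with x have r: "1 \<le> r - 1" "Suc (r - 1) = r" "row_length S r < row_length S (r - 1)"
      "c = Suc (row_length S r)"
      by (auto simp: mem_addable_iff[OF assms])
    then have "(r - 1, row_length S (r - 1)) \<in> removable S" by (simp add: mem_removable_iff[OF assms])
    moreover have "x = ?f (r - 1, row_length S (r - 1))" using r by simp
    ultimately show ?thesis by blast
  qed (use x in \<open>auto simp: mem_addable_iff[OF assms]\<close>)
qed (auto simp: mem_addable_iff[OF assms] mem_removable_iff[OF assms])

lemma finite_addable:
  assumes "shape S"
  shows "finite (addable S)"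
  using finite_removable[OF shapeD(1)[OF assms]]
  by (simp add: addable_eq_insert_image_removable[OF assms])

text \<open>Each removable square in row \<open>r\<close> cancels against the addable square in row \<open>r + 1\<close>; only
  the addable square in row 1 survives.\<close>

lemma sum_row_sign_addable_removable:
  assumes "shape S"
  shows "(\<Sum>c \<in> addable S. row_sign c) + (\<Sum>d \<in> removable S. row_sign d) = 1"
proof -
  let ?f = "\<lambda>(r, c). (Suc r, Suc (row_length S (Suc r)))"
  have inj: "inj_on ?f (removable S)"
    by (auto simp: inj_on_def mem_removable_iff[OF assms])
  have "(1, Suc (row_length S 1)) \<notin> ?f ` removable S"
    by (auto simp: mem_removable_iff[OF assms])
  then have "(\<Sum>c \<in> addable S. row_sign c) = 1 + (\<Sum>d \<in> removable S. row_sign (?f d))"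
    unfolding addable_eq_insert_image_removable[OF assms]
    using finite_removable[OF shapeD(1)[OF assms]] inj
    by (simp add: sum.reindex row_sign_def)
  also have "(\<Sum>d \<in> removable S. row_sign (?f d)) = - (\<Sum>d \<in> removable S. row_sign d)"
    by (auto simp: row_sign_def sum_negf[symmetric] split_beta)
  finally show ?thesis by simp
qed

section \<open>Removing the largest entry\<close>

lemma finite_SYT:
  assumes "finite S"
  shows "finite (SYT S)"
proof (rule finite_subset)
  show "SYT S \<subseteq> {T. \<forall>s. (s \<in> S \<longrightarrow> T s \<in> {1..card S}) \<and> (s \<notin> S \<longrightarrow> T s = undefined)}"
    by (auto simp: SYT_def bij_betw_def)
  show "finite {T. \<forall>s. (s \<in> S \<longrightarrow> T s \<in> {1..card S}) \<and> (s \<notin> S \<longrightarrow> T s = undefined)}"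
    using assms by (rule finite_set_of_finite_funs) simp
qed

lemma SYT_undefined: "T \<in> SYT S \<Longrightarrow> s \<notin> S \<Longrightarrow> T s = undefined"
  unfolding SYT_def by blast

lemma SYT_bij_betw: "T \<in> SYT S \<Longrightarrow> bij_betw T S {1..card S}"
  by (simp add: SYT_def)

lemma SYT_mono:
  assumes "T \<in> SYT S" "shape S" "(r, c) \<in> S" "1 \<le> r'" "r' \<le> r" "1 \<le> c'" "c' \<le> c"
  shows "T (r', c') \<le> T (r, c)"
proof -
  have "(r', c') \<in> S" "(r', c) \<in> S"
    using shapeD(3)[OF assms(2,3), of r' c'] shapeD(3)[OF assms(2,3), of r' c] assms(4-) by auto
  then have "T (r', c') \<le> T (r', c)" "T (r', c) \<le> T (r, c)"
    using assms by (auto simp: SYT_def le_less)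
  then show ?thesis by simp
qed

lemma SYT_insert_max:
  assumes S: "shape S" and d: "d \<in> removable S" and T: "T \<in> SYT (S - {d})"
  shows "T(d := card S) \<in> SYT S"
proof -
  have fin: "finite S" and dS: "d \<in> S" and sh: "shape (S - {d})"
    using d shapeD(1)[OF S] by (auto simp: removable_def)
  have n: "card S = Suc (card (S - {d}))" using fin dS by (rule card.remove)
  have bij: "bij_betw T (S - {d}) {1..card (S - {d})}" using T by (simp add: SYT_def)
  have lt: "T s < card S" if "s \<in> S - {d}" for s
    using bij_betwE[OF bij] that n by (metis atLeastAtMost_iff le_imp_less_Suc)
  have "bij_betw (T(d := card S)) (S - {d}) {1..card (S - {d})}"
    using bij by (subst bij_betw_cong[of _ _ T]) auto
  then have "bij_betw (T(d := card S)) (insert d (S - {d})) (insert (card S) {1..card (S - {d})})"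
    using n notIn_Un_bij_betw[of d "S - {d}" "T(d := card S)" "{1..card (S - {d})}"] by simp
  moreover have "insert d (S - {d}) = S" using dS by auto
  moreover have "insert (card S) {1..card (S - {d})} = {1..card S}" using n by auto
  ultimately have "bij_betw (T(d := card S)) S {1..card S}" by simp
  moreover have "(T(d := card S)) (r, c) < (T(d := card S)) (r, c')"
    if "(r, c) \<in> S" "(r, c') \<in> S" "c < c'" for r c c'
  proof -
    \<comment> \<open>Since \<open>S - {d}\<close> is down-closed, \<open>d\<close> has no square of
      the shape to its right, so the new maximum can only stand on the larger side. Columns are
      treated alike.\<close>
    have "(r, c) \<noteq> d"
      using shapeD(3)[OF sh, of r c' r c] that shapeD(2)[OF S] by (auto simp: all_squares_def)
    then show ?thesis using that lt T by (auto simp: SYT_def)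
  qed
  moreover have "(T(d := card S)) (r, c) < (T(d := card S)) (r', c)"
    if "(r, c) \<in> S" "(r', c) \<in> S" "r < r'" for r r' c
  proof -
    have "(r, c) \<noteq> d"
      using shapeD(3)[OF sh, of r' c r c] that shapeD(2)[OF S] by (auto simp: all_squares_def)
    then show ?thesis using that lt T by (auto simp: SYT_def)
  qed
  ultimately show ?thesis using T dS unfolding SYT_def by auto
qed

text \<open>By \<open>SYT_mono\<close> every square weakly above and to the left of a square with a
  smaller entry also carries an entry below the maximum, so deleting the maximum leaves a
  down-closed set.\<close>

lemma SYT_remove_max:
  assumes S: "shape S" and T: "T \<in> SYT S" and d: "d \<in> S" "T d = card S"
  shows "d \<in> removable S" and "T(d := undefined) \<in> SYT (S - {d})"
proof -
  have fin: "finite S" using shapeD(1)[OF S] .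
  have n: "card S = Suc (card (S - {d}))" using fin d(1) by (rule card.remove)
  have bij: "bij_betw T S {1..card S}" using T by (simp add: SYT_def)
  have lt: "T s < card S" if "s \<in> S" "s \<noteq> d" for s
  proof -
    have "T s \<noteq> T d" using bij that d by (auto simp: bij_betw_def inj_on_def)
    moreover have "T s \<le> card S" using bij that by (auto simp: bij_betw_def)
    ultimately show ?thesis using d by simp
  qed
  have "shape (S - {d})"
  proof (rule shapeI)
    fix r c r' c' assume *: "(r, c) \<in> S - {d}" "1 \<le> r'" "r' \<le> r" "1 \<le> c'" "c' \<le> c"
    then have "T (r', c') < card S"
      using SYT_mono[OF T S, of r c r' c'] lt[of "(r, c)"] by auto
    then show "(r', c') \<in> S - {d}" using shapeD(3)[OF S, of r c r' c'] * d by auto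
  qed (use fin shapeD(2)[OF S] in auto)
  then show "d \<in> removable S" using d by (simp add: removable_def)
  have "bij_betw T (S - {d}) ({1..card S} - {T d})"
    using notIn_Un_bij_betw3[of d "S - {d}" T "{1..card S} - {T d}"] bij bij_betwE[OF bij] d(1)
    by (simp add: insert_absorb)
  moreover have "{1..card S} - {T d} = {1..card (S - {d})}" using n d by auto
  ultimately have "bij_betw (T(d := undefined)) (S - {d}) {1..card (S - {d})}"
    by (subst bij_betw_cong[of _ _ T]) auto
  then show "T(d := undefined) \<in> SYT (S - {d})" using T by (auto simp: SYT_def)
qed

lemma bij_betw_SYT_removable:
  assumes S: "shape S" and ne: "S \<noteq> {}"
  shows "bij_betw (\<lambda>(d, T). T(d := card S)) (SIGMA d:removable S. SYT (S - {d})) (SYT S)"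
  (is "bij_betw ?f ?A _")
proof (rule bij_betw_imageI)
  have fin: "finite S" using shapeD(1)[OF S] .
  show "inj_on ?f ?A"
  proof (rule inj_onI)
    fix p q assume pq: "p \<in> ?A" "q \<in> ?A" "?f p = ?f q"
    obtain d T d' T' where [simp]: "p = (d, T)" "q = (d', T')" by fastforce
    have a: "d \<in> removable S" "T \<in> SYT (S - {d})" "d' \<in> removable S" "T' \<in> SYT (S - {d'})"
      and eq: "T(d := card S) = T'(d' := card S)"
      using pq by auto
    have inj: "inj_on (T(d := card S)) S"
      using SYT_insert_max[OF S a(1,2)] by (auto simp: SYT_def bij_betw_def)
    have "(T(d := card S)) d = (T(d := card S)) d'" by (metis eq fun_upd_same)
    moreover have "d \<in> S" "d' \<in> S" using a(1,3) by (auto simp: removable_def)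
    ultimately have dd: "d = d'" by (rule inj_onD[OF inj])
    \<comment> \<open>The position of the maximum has determined \<open>d\<close>; the default value
      outside the shape now determines the smaller tableau as a function.\<close>
    have "T d = undefined" "T' d = undefined" using a dd by (simp_all add: SYT_undefined)
    then have "T = T'" using eq dd by (metis fun_upd_triv fun_upd_upd)
    with dd show "p = q" by simp
  qed
  show "?f ` ?A = SYT S"
  proof (intro equalityI subsetI)
    fix T assume T: "T \<in> SYT S"
    then have bij: "T ` S = {1..card S}" by (simp add: SYT_def bij_betw_def)
    have "0 < card S" using fin ne by (simp add: card_gt_0_iff)
    then have "card S \<in> T ` S" using bij by simp
    then obtain d where d: "d \<in> S" "T d = card S" by (metis imageE)
    show "T \<in> ?f ` ?A"
    proof (rule image_eqI)
      show "T = ?f (d, T(d := undefined))" using d(2)[symmetric] by simp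
      show "(d, T(d := undefined)) \<in> ?A" using SYT_remove_max[OF S T d] by auto
    qed
  qed (use SYT_insert_max[OF S] in auto)
qed

section \<open>Reading order and the sign recursion\<close>

definition reads_before :: "square \<Rightarrow> square \<Rightarrow> bool" where
  "reads_before s t \<longleftrightarrow> fst s < fst t \<or> fst s = fst t \<and> snd s < snd t"

text \<open>A list sorted by the strict reading order has no repetitions, so positions can be
  replaced by squares and inversions become pairs of squares.\<close>

lemma card_inversions_map:
  assumes "sorted_wrt reads_before xs"
  shows "card (inversions (map T xs)) =
    card {(s, t). s \<in> set xs \<and> t \<in> set xs \<and> reads_before s t \<and> T t < T s}"
proof -
  have nth: "reads_before (xs ! i) (xs ! j)" if "i < j" "j < length xs" for i j
    using assms that by (simp add: sorted_wrt_iff_nth_less)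
  have asym: "reads_before s t \<Longrightarrow> \<not> reads_before t s" for s t by (auto simp: reads_before_def)
  have lt: "i < j" if "reads_before (xs ! i) (xs ! j)" "i < length xs" "j < length xs" for i j
    using that nth[of j i] asym asym[of "xs ! i" "xs ! i"] by (metis linorder_neqE_nat)
  have dist: "i = j" if "xs ! i = xs ! j" "i < length xs" "j < length xs" for i j
    using that nth[of i j] nth[of j i] asym by (metis linorder_neqE_nat)
  have "bij_betw (\<lambda>(i, j). (xs ! i, xs ! j)) (inversions (map T xs))
    {(s, t). s \<in> set xs \<and> t \<in> set xs \<and> reads_before s t \<and> T t < T s}"
  proof (rule bij_betw_imageI)
    show "inj_on (\<lambda>(i, j). (xs ! i, xs ! j)) (inversions (map T xs))"
      by (rule inj_onI) (auto simp: inversions_def intro: dist)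
    show "(\<lambda>(i, j). (xs ! i, xs ! j)) ` inversions (map T xs) =
      {(s, t). s \<in> set xs \<and> t \<in> set xs \<and> reads_before s t \<and> T t < T s}" (is "?f ` _ = ?R")
    proof (intro equalityI subsetI)
      fix p assume "p \<in> ?f ` inversions (map T xs)"
      then show "p \<in> ?R" by (auto simp: inversions_def intro: nth)
    next
      fix p assume p: "p \<in> ?R"
      then have "fst p \<in> set xs" "snd p \<in> set xs" by auto
      then obtain i j where ij: "p = (xs ! i, xs ! j)" "i < length xs" "j < length xs"
        by (metis in_set_conv_nth prod.collapse)
      with p have "(i, j) \<in> inversions (map T xs)" using lt by (auto simp: inversions_def)
      then show "p \<in> ?f ` inversions (map T xs)" using ij by force
    qed
  qed
  then show ?thesis by (rule bij_betw_same_card)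
qed

lemma sorted_wrt_concat_map:
  assumes "sorted_wrt Q rs" "\<And>r. r \<in> set rs \<Longrightarrow> sorted_wrt P (f r)"
    and "\<And>r r' x y. Q r r' \<Longrightarrow> x \<in> set (f r) \<Longrightarrow> y \<in> set (f r') \<Longrightarrow> P x y"
  shows "sorted_wrt P (concat (map f rs))"
  using assms(1,2) by (induction rs) (auto simp: sorted_wrt_append intro: assms(3))

lemma tableau_sign_eq:
  assumes "finite S"
  shows "tableau_sign S T = (-1) ^ card {(s, t). s \<in> S \<and> t \<in> S \<and> reads_before s t \<and> T t < T s}"
proof -
  \<comment> \<open>The squares of \<open>S\<close> in reading order; the reading word is the image
    of this list under \<open>T\<close>.\<close>
  define xs where "xs = concat (map (\<lambda>r. map (Pair r) (sorted_list_of_set {c. (r, c) \<in> S}))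
    (sorted_list_of_set (fst ` S)))"
  have finr: "finite {c. (r, c) \<in> S}" for r
    by (rule finite_subset[OF _ finite_imageI[OF assms, of snd]]) force
  have "reading_word S T = map T xs"
    by (simp add: reading_word_def xs_def map_concat comp_def)
  moreover have "set xs = S" using assms finr by (force simp: xs_def)
  moreover have "sorted_wrt reads_before xs"
    unfolding xs_def
    by (rule sorted_wrt_concat_map[where Q = "(<)"])
      (auto simp: sorted_wrt_map reads_before_def)
  ultimately show ?thesis
    by (simp add: tableau_sign_def word_sign_def card_inversions_map)
qed

text \<open>Only rows strictly below count, so the value is the same whether or not \<open>d\<close>
  itself belongs to \<open>S\<close>.\<close>

definition below_sign :: "square set \<Rightarrow> square \<Rightarrow> int" where
  "below_sign S d = (-1) ^ card {t \<in> S. fst d < fst t}"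

text \<open>The maximum forms an inversion with exactly the squares read after it. As
  \<open>d\<close> ends its row, these are the squares in lower rows; all other inversions are those
  of \<open>T\<close>.\<close>

lemma tableau_sign_insert_max:
  assumes S: "shape S" and d: "d \<in> removable S" and T: "T \<in> SYT (S - {d})"
  shows "tableau_sign S (T(d := card S)) = below_sign S d * tableau_sign (S - {d}) T"
proof -
  have fin: "finite S" and dS: "d \<in> S" and sh: "shape (S - {d})"
    using d shapeD(1)[OF S] by (auto simp: removable_def)
  have n: "card S = Suc (card (S - {d}))" using fin dS by (rule card.remove)
  have lt: "T s < card S" if "s \<in> S" "s \<noteq> d" for s
  proof -
    have "T s \<in> {1..card (S - {d})}" using bij_betwE[OF SYT_bij_betw[OF T]] that by blast
    then show ?thesis using n by simp
  qed
  let ?T = "T(d := card S)"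
  let ?I = "{(s, t). s \<in> S \<and> t \<in> S \<and> reads_before s t \<and> ?T t < ?T s}"
  let ?J = "{(s, t). s \<in> S - {d} \<and> t \<in> S - {d} \<and> reads_before s t \<and> T t < T s}"
  have last: "fst d < fst t" if t: "t \<in> S" "reads_before d t" for t
  proof (rule ccontr)
    assume "\<not> fst d < fst t"
    then obtain r c c' where rc: "d = (r, c)" "t = (r, c')" "c < c'"
      using t(2) by (cases d; cases t) (auto simp: reads_before_def)
    then have "(r, c) \<in> S - {d}"
      using shapeD(3)[OF sh, of r c' r c] shapeD(2)[OF S] t(1) dS by (auto simp: all_squares_def)
    then show False using rc by simp
  qed
  have I: "?I = Pair d ` {t \<in> S. fst d < fst t} \<union> ?J"
  proof (intro equalityI subsetI)
    fix p assume "p \<in> ?I"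
    then show "p \<in> Pair d ` {t \<in> S. fst d < fst t} \<union> ?J"
      using lt last by (force split: if_splits)
  next
    fix p assume "p \<in> Pair d ` {t \<in> S. fst d < fst t} \<union> ?J"
    then show "p \<in> ?I" using lt dS by (auto simp: reads_before_def)
  qed
  have finJ: "finite ?J" by (rule finite_subset[of _ "S \<times> S"]) (use fin in auto)
  have "card ?I = card {t \<in> S. fst d < fst t} + card ?J"
    unfolding I using fin finJ by (subst card_Un_disjoint) (auto simp: card_image inj_on_def)
  then show ?thesis
    by (simp add: tableau_sign_eq[OF fin] tableau_sign_eq[OF finite_Diff[OF fin]]
        below_sign_def power_add)
qed

lemma sign_imbalance_removable:
  assumes S: "shape S" and ne: "S \<noteq> {}"
  shows "sign_imbalance S = (\<Sum>d \<in> removable S. below_sign S d * sign_imbalance (S - {d}))"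
proof -
  have fin: "finite S" using shapeD(1)[OF S] .
  have "sign_imbalance S =
    (\<Sum>(d, T) \<in> (SIGMA d:removable S. SYT (S - {d})). tableau_sign S (T(d := card S)))"
    unfolding sign_imbalance_def
    by (subst sum.reindex_bij_betw[OF bij_betw_SYT_removable[OF S ne], symmetric])
      (simp add: split_beta)
  also have "\<dots> = (\<Sum>(d, T) \<in> (SIGMA d:removable S. SYT (S - {d})).
      below_sign S d * tableau_sign (S - {d}) T)"
    by (rule sum.cong) (auto simp: tableau_sign_insert_max[OF S])
  also have "\<dots> = (\<Sum>d \<in> removable S. below_sign S d * sign_imbalance (S - {d}))"
    using fin by (simp add: sum.Sigma[symmetric] finite_removable finite_SYT sign_imbalance_def
        sum_distrib_left)
  finally show ?thesis .
qed

section \<open>Adding and removing squares with signs\<close>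

lemma below_sign_insert:
  assumes "finite S" "c \<notin> S"
  shows "below_sign (insert c S) d = (if fst d < fst c then - below_sign S d else below_sign S d)"
proof -
  have "{t \<in> insert c S. fst d < fst t} =
    (if fst d < fst c then insert c {t \<in> S. fst d < fst t} else {t \<in> S. fst d < fst t})"
    by auto
  then show ?thesis using assms by (simp add: below_sign_def)
qed

lemma below_sign_square: "below_sign S d * below_sign S d = 1"
  by (simp add: below_sign_def flip: power_add)

lemma removable_fst_inj:
  assumes "shape S" "d \<in> removable S" "d' \<in> removable S" "fst d = fst d'"
  shows "d = d'"
  using assms(2-) by (cases d; cases d') (simp add: mem_removable_iff[OF assms(1)])

text \<open>Shapes form a lattice under union and intersection. Either order of adding
  \<open>c\<close> and removing \<open>d\<close> yields a shape, and the fourth corner of the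
  diamond is the intersection or the union of that shape with \<open>S\<close>.\<close>

lemma addable_removable_swap:
  assumes S: "shape S"
  shows "c \<in> addable S \<and> d \<in> removable (insert c S) \<and> d \<noteq> c \<longleftrightarrow>
    d \<in> removable S \<and> c \<in> addable (S - {d}) \<and> c \<noteq> d" (is "?L \<longleftrightarrow> ?R")
proof
  assume L: ?L
  then have "shape (S \<inter> (insert c S - {d}))"
    by (intro shape_Int S) (auto simp: removable_def)
  moreover have "S \<inter> (insert c S - {d}) = S - {d}" by auto
  moreover have "insert c S - {d} = insert c (S - {d})" using L by auto
  ultimately show ?R using L by (auto simp: addable_def removable_def)
next
  assume R: ?R
  then have "shape (S \<union> insert c (S - {d}))"
    by (intro shape_Un S) (auto simp: addable_def)
  moreover have "S \<union> insert c (S - {d}) = insert c S" by auto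
  moreover have "insert c S - {d} = insert c (S - {d})" using R by auto
  ultimately show ?L using R by (auto simp: addable_def removable_def)
qed

text \<open>Both squares are removable from \<open>insert c S\<close>, hence lie in different rows.
  The presence of the lower one flips the sign attached to the upper one, and not conversely, so
  exactly one of the two factors changes.\<close>

lemma below_sign_swap:
  assumes S: "shape S" and c: "c \<in> addable S" and d: "d \<in> removable (insert c S)" "d \<noteq> c"
  shows "below_sign S c * below_sign (insert c S) d = - (below_sign S d * below_sign (S - {d}) c)"
proof -
  have sh: "shape (insert c S)" and cS: "c \<notin> S" using c by (auto simp: addable_def)
  have fin: "finite S" using shapeD(1)[OF S] .
  have "c \<in> removable (insert c S)" using S cS by (simp add: removable_def)
  then have ne: "fst c \<noteq> fst d" using removable_fst_inj[OF sh d(1)] d(2) by metis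
  have "S = insert d (S - {d})" using d by (auto simp: removable_def)
  then have "below_sign S c = (if fst c < fst d then - below_sign (S - {d}) c else below_sign (S - {d}) c)"
    using below_sign_insert[of "S - {d}" d c] fin by simp
  then show ?thesis using below_sign_insert[OF fin cS, of d] ne by auto
qed

text \<open>Expanding the left-hand side over removable squares, the pairs that add \<open>c\<close> and remove
  \<open>d \<noteq> c\<close> anticommute, so they are governed by the identity for \<open>S - {d}\<close>.\<close>

lemma sum_addable_sign_imbalance:
  assumes "shape S"
  shows "(\<Sum>c \<in> addable S. row_sign c * below_sign S c * sign_imbalance (insert c S)) =
    (if even (card S) then sign_imbalance S else 0)"
  using assms
proof (induction "card S" arbitrary: S rule: less_induct)
  case less
  note S = less.prems
  have fin: "finite S" using shapeD(1)[OF S] .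
  let ?I = sign_imbalance
  \<comment> \<open>The summand of the claim for the smaller shape \<open>S - {d}\<close>, to which
    the induction hypothesis applies.\<close>
  define F where "F c d = row_sign c * below_sign (S - {d}) c * ?I (insert c (S - {d}))" for c d
  \<comment> \<open>Expand \<open>insert c S\<close> over its removable squares. Removing
    \<open>c\<close> again gives the first term, as the two equal signs multiply to 1; the other
    terms change sign by the swap.\<close>
  have step: "row_sign c * below_sign S c * ?I (insert c S) = row_sign c * ?I S
      - (\<Sum>d \<in> removable (insert c S) - {c}. below_sign S d * F c d)" if c: "c \<in> addable S" for c
  proof -
    have sh: "shape (insert c S)" and cS: "c \<notin> S" using c by (auto simp: addable_def)
    have cr: "c \<in> removable (insert c S)" using S cS by (simp add: removable_def)
    have finr: "finite (removable (insert c S))" using fin by (simp add: finite_removable)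
    have same: "below_sign (insert c S) c = below_sign S c"
      using below_sign_insert[OF fin cS, of c] by simp
    have "?I (insert c S) = below_sign S c * ?I S +
      (\<Sum>d \<in> removable (insert c S) - {c}. below_sign (insert c S) d * ?I (insert c S - {d}))"
      by (subst sign_imbalance_removable[OF sh]) (simp_all add: sum.remove[OF finr cr] same cS)
    then have "row_sign c * below_sign S c * ?I (insert c S) =
      row_sign c * ?I S * (below_sign S c * below_sign S c) +
      (\<Sum>d \<in> removable (insert c S) - {c}.
        row_sign c * (below_sign S c * below_sign (insert c S) d) * ?I (insert c S - {d}))"
      by (simp add: algebra_simps sum_distrib_left)
    also have "(\<Sum>d \<in> removable (insert c S) - {c}.
        row_sign c * (below_sign S c * below_sign (insert c S) d) * ?I (insert c S - {d})) =
      (\<Sum>d \<in> removable (insert c S) - {c}. - (below_sign S d * F c d))"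
    proof (rule sum.cong)
      fix d assume "d \<in> removable (insert c S) - {c}"
      then have d: "d \<in> removable (insert c S)" "d \<noteq> c" by auto
      have "insert c S - {d} = insert c (S - {d})" using d by auto
      then show "row_sign c * (below_sign S c * below_sign (insert c S) d) * ?I (insert c S - {d}) =
          - (below_sign S d * F c d)"
        by (simp only: below_sign_swap[OF S c d] F_def) (simp add: algebra_simps)
    qed simp
    finally show ?thesis by (simp add: below_sign_square sum_negf)
  qed
  \<comment> \<open>The induction hypothesis sums over all addable squares of
    \<open>S - {d}\<close>, including \<open>d\<close> itself; splitting off that term gives
    \<open>row_sign d\<close> times the imbalance of \<open>S\<close>. The parity condition flips
    because one square is missing.\<close>
  have inner: "below_sign S d * (\<Sum>c \<in> addable (S - {d}) - {d}. F c d) =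
      (if even (card S) then 0 else below_sign S d * ?I (S - {d})) - row_sign d * ?I S"
    if d: "d \<in> removable S" for d
  proof -
    have sh: "shape (S - {d})" and dS: "d \<in> S" using d by (auto simp: removable_def)
    have n: "card S = Suc (card (S - {d}))" using fin dS by (rule card.remove)
    have da: "d \<in> addable (S - {d})" using S dS by (simp add: addable_def insert_absorb)
    have same: "below_sign (S - {d}) d = below_sign S d"
      using below_sign_insert[of "S - {d}" d d] fin dS by (simp add: insert_absorb)
    have "F d d + (\<Sum>c \<in> addable (S - {d}) - {d}. F c d) = (\<Sum>c \<in> addable (S - {d}). F c d)"
      using sum.remove[OF finite_addable[OF sh] da, of "\<lambda>c. F c d"] by simp
    also have "\<dots> = (if even (card S) then 0 else ?I (S - {d}))"
      using less.hyps[of "S - {d}"] sh n by (simp add: F_def)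
    also have "F d d = row_sign d * below_sign S d * ?I S"
      using same dS by (simp add: F_def insert_absorb)
    finally have eq: "(\<Sum>c \<in> addable (S - {d}) - {d}. F c d) =
      (if even (card S) then 0 else ?I (S - {d})) - row_sign d * below_sign S d * ?I S" by simp
    have "below_sign S d * (\<Sum>c \<in> addable (S - {d}) - {d}. F c d) =
      below_sign S d * (if even (card S) then 0 else ?I (S - {d}))
        - row_sign d * ?I S * (below_sign S d * below_sign S d)"
      by (simp only: eq right_diff_distrib mult_ac)
    then show ?thesis by (simp add: below_sign_square)
  qed
  have fr: "finite (removable S)" by (rule finite_removable[OF fin])
  have fa: "finite (addable S)" by (rule finite_addable[OF S])
  have "(\<Sum>c \<in> addable S. \<Sum>d \<in> removable (insert c S) - {c}. below_sign S d * F c d) =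
      (\<Sum>(c, d) \<in> (SIGMA c:addable S. removable (insert c S) - {c}). below_sign S d * F c d)"
    using fa fin by (subst sum.Sigma) (auto intro: finite_removable)
  also have "\<dots> = (\<Sum>(d, c) \<in> (SIGMA d:removable S. addable (S - {d}) - {d}). below_sign S d * F c d)"
  proof (rule sum.reindex_bij_witness[where i = prod.swap and j = prod.swap])
    fix p assume "p \<in> (SIGMA c:addable S. removable (insert c S) - {c})"
    then show "prod.swap p \<in> (SIGMA d:removable S. addable (S - {d}) - {d})"
      using addable_removable_swap[OF S, of "fst p" "snd p"] by (cases p) simp
  next
    fix p assume "p \<in> (SIGMA d:removable S. addable (S - {d}) - {d})"
    then show "prod.swap p \<in> (SIGMA c:addable S. removable (insert c S) - {c})"
      using addable_removable_swap[OF S, of "snd p" "fst p"] by (cases p) simp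
  qed (auto simp: split_beta)
  also have "\<dots> = (\<Sum>d \<in> removable S. \<Sum>c \<in> addable (S - {d}) - {d}. below_sign S d * F c d)"
    using fr by (subst sum.Sigma) (auto intro: finite_addable simp: removable_def)
  also have "\<dots> = (\<Sum>d \<in> removable S.
      (if even (card S) then 0 else below_sign S d * ?I (S - {d})) - row_sign d * ?I S)"
    by (rule sum.cong) (simp_all add: sum_distrib_left[symmetric] inner)
  also have "\<dots> = (if even (card S) then 0 else ?I S) - (\<Sum>d \<in> removable S. row_sign d) * ?I S"
    \<comment> \<open>The empty shape, to which the recursion does not apply, has even size and no
      removable square, so both sides vanish.\<close>
    using sign_imbalance_removable[OF S]
    by (cases "S = {}") (simp_all add: sum_subtractf sum_distrib_right sum_negf)
  finally have "(\<Sum>c \<in> addable S. row_sign c * below_sign S c * ?I (insert c S)) =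
    (\<Sum>c \<in> addable S. row_sign c) * ?I S -
    ((if even (card S) then 0 else ?I S) - (\<Sum>d \<in> removable S. row_sign d) * ?I S)"
    by (simp add: step sum_subtractf sum_distrib_right)
  \<comment> \<open>The two row sign sums combine to 1, leaving the imbalance of \<open>S\<close>,
    which the subtracted term cancels precisely for odd size.\<close>
  also have "\<dots> = ((\<Sum>c \<in> addable S. row_sign c) + (\<Sum>d \<in> removable S. row_sign d)) * ?I S
      - (if even (card S) then 0 else ?I S)"
    by (simp add: algebra_simps)
  finally show ?case by (simp add: sum_row_sign_addable_removable[OF S])
qed

section \<open>Colour balance of shapes with nonzero imbalance\<close>

lemma removable_same_color_swap:
  assumes S: "shape S" and d: "d \<in> removable S" and d': "d' \<in> removable (S - {d})"
    and col: "black d = black d'"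
  shows "d' \<in> removable S" and "d \<in> removable (S - {d'})"
proof -
  have sh: "shape (S - {d})" "shape (S - {d} - {d'})" and mem: "d \<in> S" "d' \<in> S" "d \<noteq> d'"
    using d d' by (auto simp: removable_def)
  obtain r c where [simp]: "d' = (r, c)" by fastforce
  \<comment> \<open>Only a square directly below or to the right of \<open>d'\<close> could keep it
    from being removable in \<open>S\<close>, and such neighbours have the opposite colour.\<close>
  have adj: "d \<noteq> (Suc r, c)" "d \<noteq> (r, Suc c)" using col by (auto simp: black_def)
  have pos: "1 \<le> r" "1 \<le> c" using mem shapeD(2)[OF S] by (auto simp: all_squares_def)
  have nin: "(Suc r, c) \<notin> S" "(r, Suc c) \<notin> S"
    using shapeD(3)[OF sh(2), of "Suc r" c r c] shapeD(3)[OF sh(2), of r "Suc c" r c] pos adj by auto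
  have len: "row_length S r = c" "row_length S (Suc r) < c"
    using nin mem shape_mem_iff[OF S, of r c] shape_mem_iff[OF S, of r "Suc c"]
      shape_mem_iff[OF S, of "Suc r" c] by auto
  then show "d' \<in> removable S" using pos by (simp add: mem_removable_iff[OF S])
  moreover have "S - {d'} - {d} = S - {d} - {d'}" by auto
  ultimately show "d \<in> removable (S - {d'})" using sh mem by (auto simp: removable_def)
qed

text \<open>Swapping two consecutively removed squares of the same colour reverses the sign, so these
  pairs cancel in the twice expanded imbalance.\<close>

lemma sign_imbalance_nonzero_remove_two:
  assumes S: "shape S" and n: "2 \<le> card S" and nz: "sign_imbalance S \<noteq> 0"
  obtains d d' where "d \<in> removable S" "d' \<in> removable (S - {d})" "black d \<noteq> black d'"
    "sign_imbalance (S - {d} - {d'}) \<noteq> 0"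
proof (rule ccontr)
  note found = that
  assume contra: "\<not> thesis"
  have zero: "sign_imbalance (S - {d} - {d'}) = 0"
    if "d \<in> removable S" "d' \<in> removable (S - {d})" "black d \<noteq> black d'" for d d'
    using found[of d d'] contra that by blast
  have fin: "finite S" using shapeD(1)[OF S] .
  define f where "f = (\<lambda>(d, d'). below_sign S d * below_sign (S - {d}) d' * sign_imbalance (S - {d} - {d'}))"
  define P where "P = (SIGMA d:removable S. removable (S - {d}))"
  define Q where "Q = {(d, d') \<in> P. black d = black d'}"
  have finP: "finite P" using fin by (auto simp: P_def intro!: finite_removable)
  have exp: "sign_imbalance (S - {d}) =
    (\<Sum>d' \<in> removable (S - {d}). below_sign (S - {d}) d' * sign_imbalance (S - {d} - {d'}))"
    if "d \<in> removable S" for d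
  proof (rule sign_imbalance_removable)
    show "shape (S - {d})" using that by (simp add: removable_def)
    have "0 < card (S - {d})" using n fin that by (simp add: removable_def)
    then show "S - {d} \<noteq> {}" by (metis card.empty less_irrefl)
  qed
  have "S \<noteq> {}" using n by auto
  then have "sign_imbalance S = (\<Sum>d \<in> removable S. \<Sum>d' \<in> removable (S - {d}). f (d, d'))"
    by (subst sign_imbalance_removable[OF S])
      (auto simp: exp f_def sum_distrib_left mult.assoc intro!: sum.cong)
  also have "\<dots> = sum f P"
    unfolding P_def using fin by (subst sum.Sigma) (auto intro!: finite_removable)
  \<comment> \<open>Under the assumption being refuted, pairs of different colours contribute 0, so
    only pairs of equal colour remain; exchanging their entries maps \<open>Q\<close> onto
    itself.\<close>
  also have "\<dots> = sum f Q"
  proof (rule sum.mono_neutral_right[OF finP])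
    show "Q \<subseteq> P" by (auto simp: Q_def)
    show "\<forall>p \<in> P - Q. f p = 0"
    proof
      fix p assume "p \<in> P - Q"
      then show "f p = 0" using zero[of "fst p" "snd p"] by (cases p) (simp add: P_def Q_def f_def)
    qed
  qed
  finally have eq: "sign_imbalance S = sum f Q" .
  have "sum f Q = (\<Sum>q \<in> Q. f (prod.swap q))"
    by (rule sum.reindex_bij_witness[where i = prod.swap and j = prod.swap])
      (auto simp: P_def Q_def intro: removable_same_color_swap[OF S])
  also have "\<dots> = (\<Sum>q \<in> Q. - f q)"
  proof (rule sum.cong)
    fix q assume "q \<in> Q"
    then obtain d d' where q: "q = (d, d')" "d \<in> removable S" "d' \<in> removable (S - {d})" "black d = black d'"
      by (auto simp: P_def Q_def)
    have d': "d' \<in> removable S" "d \<in> removable (S - {d'})"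
      using removable_same_color_swap[OF S q(2-4)] by auto
    have sh: "shape (S - {d})" and mem: "d \<in> S" "d' \<in> S" "d \<noteq> d'"
      using q d' by (auto simp: removable_def)
    have c: "d \<in> addable (S - {d})" using S mem by (simp add: addable_def insert_absorb)
    have ins: "insert d (S - {d}) = S" using mem by auto
    \<comment> \<open>The exchange rule for the shape \<open>S - {d}\<close>, with \<open>d\<close>
      added back and \<open>d'\<close> then removed. It groups the four signs differently from the
      two removal orders; as each sign squares to 1, they can be regrouped.\<close>
    have swap: "below_sign (S - {d}) d * below_sign S d' =
      - (below_sign (S - {d}) d' * below_sign (S - {d} - {d'}) d)"
      using below_sign_swap[OF sh c, of d'] d' mem ins by simp
    have same: "below_sign (S - {d}) d = below_sign S d"
      using below_sign_insert[of "S - {d}" d d] fin ins by simp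
    have "insert d (S - {d} - {d'}) = S - {d'}" using mem by auto
    then have same': "below_sign (S - {d} - {d'}) d = below_sign (S - {d'}) d"
      using below_sign_insert[of "S - {d} - {d'}" d d] fin by simp
    have signs: "y * w = - (x * z)" if "x * y = - (z * w)" "x * x = 1" "w * w = 1"
      for x y z w :: int
      using that by algebra
    have "below_sign S d' * below_sign (S - {d'}) d = - (below_sign S d * below_sign (S - {d}) d')"
      using swap unfolding same same' by (rule signs) (rule below_sign_square)+
    moreover have "S - {d'} - {d} = S - {d} - {d'}" by auto
    ultimately show "f (prod.swap q) = - f q" by (simp add: f_def q(1))
  qed simp
  finally have "sum f Q = 0" by (simp add: sum_negf)
  then show False using eq nz by simp
qed

text \<open>Two squares of opposite colours are removed at a time, which preserves the difference of
  the colour counts, down to the empty shape or the single black square \<open>(1, 1)\<close>. The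
  remainder mod 2 treats both parities at once.\<close>

lemma card_black_if_sign_imbalance_nonzero:
  assumes "shape S" "sign_imbalance S \<noteq> 0"
  shows "2 * card {s \<in> S. black s} = card S + card S mod 2"
  using assms
proof (induction "card S" arbitrary: S rule: less_induct)
  case less
  note S = less.prems(1)
  have fin: "finite S" using shapeD(1)[OF S] .
  consider "card S = 0" | "card S = 1" | "2 \<le> card S" by linarith
  then show ?case
  proof cases
    case 1
    then show ?thesis using fin by simp
  next
    case 2
    then obtain s where s: "S = {s}" by (auto simp: card_1_singleton_iff)
    then have "(1, 1) \<in> S"
      using shapeD(3)[OF S, of "fst s" "snd s" 1 1] shapeD(2)[OF S] by (auto simp: all_squares_def)
    then have "{s \<in> S. black s} = S" using s by (auto simp: black_def)
    then show ?thesis using 2 by simp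
  next
    case 3
    obtain d d' where d: "d \<in> removable S" "d' \<in> removable (S - {d})" "black d \<noteq> black d'"
      "sign_imbalance (S - {d} - {d'}) \<noteq> 0"
      using sign_imbalance_nonzero_remove_two[OF S 3 less.prems(2)] .
    let ?U = "S - {d} - {d'}"
    have sh: "shape ?U" and mem: "d \<in> S" "d' \<in> S" "d \<noteq> d'" using d by (auto simp: removable_def)
    have card: "card S = card ?U + 2" using fin mem 3 by simp
    define e where "e = (if black d then d else d')"
    have "{s \<in> S. black s} = insert e {s \<in> ?U. black s}"
      using d(3) mem by (auto simp: e_def)
    moreover have "e \<notin> {s \<in> ?U. black s}" by (simp add: e_def)
    ultimately have "card {s \<in> S. black s} = Suc (card {s \<in> ?U. black s})" using fin by simp
    then show ?thesis using less.hyps[OF _ sh d(4)] card by simp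
  qed
qed

section \<open>Vertical dominoes and the signed sum of squares\<close>

text \<open>Every vertical domino covers exactly one square in an even row, which bounds the number
  of disjoint ones. Conversely, each such square together with the one above it is a domino, and
  these are disjoint.\<close>

lemma max_vertical_dominoes_eq:
  assumes S: "shape S"
  shows "max_vertical_dominoes S = card {s \<in> S. even (fst s)}"
proof -
  let ?E = "{s \<in> S. even (fst s)}"
  have fin: "finite S" using shapeD(1)[OF S] .
  define X where "X = {card D | D. (\<forall>d \<in> D. vertical_domino d \<and> d \<subseteq> S) \<and> pairwise disjnt D}"
  have le: "k \<le> card ?E" if kX: "k \<in> X" for k
  proof -
    obtain D where D: "k = card D" "\<And>d. d \<in> D \<Longrightarrow> vertical_domino d \<and> d \<subseteq> S" "pairwise disjnt D"
      using kX unfolding X_def by blast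
    have "\<exists>s. s \<in> d \<and> even (fst s)" if dD: "d \<in> D" for d
    proof -
      obtain r c where "d = {(r, c), (r + 1, c)}" using D(2)[OF dD] by (auto simp: vertical_domino_def)
      then show ?thesis by (cases "even r") auto
    qed
    then obtain g where g: "\<And>d. d \<in> D \<Longrightarrow> g d \<in> d \<and> even (fst (g d))" by metis
    have "inj_on g D"
      using g D(3) by (metis (no_types, lifting) disjnt_iff inj_onI pairwiseD)
    moreover have "g ` D \<subseteq> ?E" using g D(2) by blast
    ultimately show ?thesis unfolding D(1) using fin by (intro card_inj_on_le) auto
  qed
  \<comment> \<open>The domino whose lower square is \<open>s\<close>; writing its row as
    \<open>fst s - 1 + 1\<close> matches the form required by
    \<open>vertical_domino\<close>.\<close>
  let ?h = "\<lambda>s. {(fst s - 1, snd s), (fst s - 1 + 1, snd s)}"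
  have pos: "1 \<le> fst s" if "s \<in> S" for s using shapeD(2)[OF S] that by (auto simp: all_squares_def)
  have disj: "disjnt (?h s) (?h t)" if "s \<in> ?E" "t \<in> ?E" "s \<noteq> t" for s t
  proof -
    have "fst s - 1 \<noteq> fst t - 1 + 1" "fst t - 1 \<noteq> fst s - 1 + 1" using that pos[of s] pos[of t] by auto presburger+
    moreover have "(fst s - 1, snd s) \<noteq> (fst t - 1, snd t)" using that pos[of s] pos[of t]
      by (auto simp: prod_eq_iff)
    ultimately show ?thesis by auto
  qed
  have "inj_on ?h ?E" using disj by (metis (no_types, lifting) disjnt_insert1 insertI1 inj_onI)
  then have "card (?h ` ?E) = card ?E" by (rule card_image)
  moreover have "card (?h ` ?E) \<in> X"
  proof -
    have "vertical_domino (?h s) \<and> ?h s \<subseteq> S" if "s \<in> ?E" for s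
    proof -
      have "2 \<le> fst s" using that pos[of s] by (auto elim: evenE)
      then have "?h s \<subseteq> S"
        using shapeD(3)[OF S, of "fst s" "snd s" "fst s - 1" "snd s"] shapeD(2)[OF S] that
        by (auto simp: all_squares_def)
      then show ?thesis unfolding vertical_domino_def by blast
    qed
    moreover have "pairwise disjnt (?h ` ?E)" by (rule pairwise_imageI) (rule disj)
    ultimately show ?thesis unfolding X_def by blast
  qed
  moreover have "finite X" using le unfolding finite_nat_set_iff_bounded_le by blast
  ultimately have "Max X = card ?E" using le by (intro Max_eqI) auto
  then show ?thesis by (simp add: max_vertical_dominoes_def X_def)
qed

lemma power_max_vertical_dominoes_insert:
  assumes "shape S" "c \<in> addable S"
  shows "(-1) ^ max_vertical_dominoes (insert c S) =
    row_sign c * ((-1) ^ max_vertical_dominoes S :: int)"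
proof -
  have sh: "shape (insert c S)" "c \<notin> S" using assms(2) by (auto simp: addable_def)
  have "{s \<in> insert c S. even (fst s)} =
    (if even (fst c) then insert c {s \<in> S. even (fst s)} else {s \<in> S. even (fst s)})" by auto
  then show ?thesis using sh shapeD(1)[OF assms(1)]
    by (simp add: max_vertical_dominoes_eq[OF assms(1)] max_vertical_dominoes_eq[OF sh(1)] row_sign_def)
qed

theorem theorem5p4:
  fixes B :: "square set" and n :: nat
  assumes "B \<subseteq> {s \<in> all_squares. black s}"
    and "even n"
    and "\<not> (n = 0 \<and> B = {})"
  shows "(\<Sum>S | shape S \<and> card S = n \<and> {s \<in> S. black s} = B.
            (-1) ^ max_vertical_dominoes S * (sign_imbalance S)\<^sup>2) = 0"
proof (cases "n = 0 \<or> 2 * card B \<noteq> n")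
  case True
  show ?thesis
  proof (rule sum.neutral, clarify)
    fix S assume S: "shape S" "n = card S" "B = {s \<in> S. black s}"
    \<comment> \<open>For \<open>n = 0\<close> and empty \<open>B\<close> the sum would be 1, from
      the single empty tableau; that case is excluded. Otherwise the colour count makes every
      imbalance vanish.\<close>
    have "n \<noteq> 0" using S assms(3) shapeD(1)[OF S(1)] by auto
    then have "sign_imbalance S = 0"
      using card_black_if_sign_imbalance_nonzero[OF S(1)] True S assms(2) by auto
    then show "(-1) ^ max_vertical_dominoes S * (sign_imbalance S)\<^sup>2 = 0" by simp
  qed
next
  case False
  let ?I = sign_imbalance
  let ?v = "\<lambda>S. (-1) ^ max_vertical_dominoes S :: int"
  define L where "L k = {S. shape S \<and> card S = k \<and> {s \<in> S. black s} = B}" for k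
  have finL: "finite (L k)" for k
    by (rule finite_subset[OF _ finite_shapes[of k]]) (auto simp: L_def)
  define g where "g S d = ?v S * ?I S * below_sign S d * ?I (S - {d})" for S d
  have remove: "?v S * (?I S)\<^sup>2 = (\<Sum>d \<in> {d \<in> removable S. \<not> black d}. g S d)" if "S \<in> L n" for S
  proof -
    have S: "shape S" "card S = n" "{s \<in> S. black s} = B" using that by (auto simp: L_def)
    have fin: "finite S" using shapeD(1)[OF S(1)] .
    have "S \<noteq> {}" using S False by auto
    then have "?v S * (?I S)\<^sup>2 = ?v S * ?I S * (\<Sum>d \<in> removable S. below_sign S d * ?I (S - {d}))"
      using sign_imbalance_removable[OF S(1)] by (simp add: power2_eq_square mult.assoc)
    also have "\<dots> = (\<Sum>d \<in> removable S. g S d)"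
      by (simp add: g_def sum_distrib_left mult.assoc)
    also have "\<dots> = (\<Sum>d \<in> {d \<in> removable S. \<not> black d}. g S d)"
    proof (rule sum.mono_neutral_right)
      show "\<forall>d \<in> removable S - {d \<in> removable S. \<not> black d}. g S d = 0"
      proof
        fix d assume "d \<in> removable S - {d \<in> removable S. \<not> black d}"
        then have d: "shape (S - {d})" "d \<in> S" "black d" by (auto simp: removable_def)
        have "{s \<in> S - {d}. black s} = B - {d}" using S by auto
        moreover have "d \<in> B" "finite B" using S(3) d fin by auto
        ultimately have c: "card B = Suc (card {s \<in> S - {d}. black s})"
          by (simp only: card.remove)
        moreover have "card S = Suc (card (S - {d}))" using fin d(2) by (rule card.remove)
        \<comment> \<open>A nonzero imbalance at the odd size \<open>n - 1\<close> requires
          \<open>n / 2\<close> black squares, but removing a black square leaves one fewer.\<close>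
        ultimately have "?I (S - {d}) = 0"
          using card_black_if_sign_imbalance_nonzero[OF d(1)] False S(2) by presburger
        then show "g S d = 0" by (simp add: g_def)
      qed
    qed (use fin in \<open>auto intro: finite_removable\<close>)
    finally show ?thesis .
  qed
  have add: "(\<Sum>c \<in> {c \<in> addable M. \<not> black c}. g (insert c M) c) = 0" if "M \<in> L (n - 1)" for M
  proof -
    have M: "shape M" "card M = n - 1" "{s \<in> M. black s} = B" using that by (auto simp: L_def)
    have fin: "finite M" using shapeD(1)[OF M(1)] .
    have "(\<Sum>c \<in> {c \<in> addable M. \<not> black c}. g (insert c M) c) =
        (\<Sum>c \<in> addable M. g (insert c M) c)"
    \<comment> \<open>The sum may be extended to all addable squares: a black one would give
      \<open>n / 2 + 1\<close> black squares at the even size \<open>n\<close>, hence imbalance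
      0.\<close>
    proof (rule sum.mono_neutral_left)
      show "\<forall>c \<in> addable M - {c \<in> addable M. \<not> black c}. g (insert c M) c = 0"
      proof
        fix c assume "c \<in> addable M - {c \<in> addable M. \<not> black c}"
        then have c: "shape (insert c M)" "c \<notin> M" "black c" by (auto simp: addable_def)
        have "{s \<in> insert c M. black s} = insert c B" using M c by auto
        moreover have "c \<notin> B" "finite B" using M(3) c fin by auto
        moreover have "card (insert c M) = n" using c fin M False by simp
        ultimately have "?I (insert c M) = 0"
          using card_black_if_sign_imbalance_nonzero[OF c(1)] False assms(2) by auto
        then show "g (insert c M) c = 0" by (simp add: g_def)
      qed
    qed (use finite_addable[OF M(1)] in auto)
    \<comment> \<open>The weight of \<open>insert c M\<close> supplies \<open>row_sign c\<close>,
      and the remaining factor depends on \<open>M\<close> alone.\<close>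
    also have "\<dots> = (\<Sum>c \<in> addable M. ?v M * ?I M * (row_sign c * below_sign M c * ?I (insert c M)))"
    proof (rule sum.cong)
      fix c assume c: "c \<in> addable M"
      then have cM: "c \<notin> M" by (simp add: addable_def)
      then show "g (insert c M) c = ?v M * ?I M * (row_sign c * below_sign M c * ?I (insert c M))"
        using below_sign_insert[OF fin cM, of c]
        by (simp add: g_def power_max_vertical_dominoes_insert[OF M(1) c] algebra_simps)
    qed simp
    \<comment> \<open>\<open>M\<close> has the odd size \<open>n - 1\<close>, where the sum over
      addable squares vanishes.\<close>
    also have "\<dots> = 0"
      using sum_addable_sign_imbalance[OF M(1)] M(2) False assms(2)
      by (simp add: sum_distrib_left[symmetric])
    finally show ?thesis .
  qed
  have "(\<Sum>S \<in> L n. ?v S * (?I S)\<^sup>2) = (\<Sum>S \<in> L n. \<Sum>d \<in> {d \<in> removable S. \<not> black d}. g S d)"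
    by (rule sum.cong) (simp_all add: remove)
  also have "\<dots> = (\<Sum>(S, d) \<in> (SIGMA S:L n. {d \<in> removable S. \<not> black d}). g S d)"
    using finL by (subst sum.Sigma) (auto simp: L_def finite_removable shapeD(1))
  \<comment> \<open>Regroup by the smaller shape. White squares do not affect the set of black
    squares, so both sides keep the same \<open>B\<close>.\<close>
  also have "\<dots> = (\<Sum>(M, c) \<in> (SIGMA M:L (n - 1). {c \<in> addable M. \<not> black c}). g (insert c M) c)"
    by (rule sum.reindex_bij_witness[where i = "\<lambda>(M, c). (insert c M, c)" and j = "\<lambda>(S, d). (S - {d}, d)"])
      (use False in \<open>auto simp: L_def addable_def removable_def insert_absorb shapeD(1)\<close>)
  also have "\<dots> = (\<Sum>M \<in> L (n - 1). \<Sum>c \<in> {c \<in> addable M. \<not> black c}. g (insert c M) c)"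
    using finL by (subst sum.Sigma) (auto simp: L_def finite_addable)
  also have "\<dots> = 0" by (simp add: add)
  finally show ?thesis by (simp add: L_def)
qed

end
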